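(* (i) For all $n\in\mathbb{N}$, $\mathscr{S}_8(n)$ is full. (ii) Let $m\in\{9,10,11\}$ and $n\in\mathbb{N}$ with $n>m$. Then $$\mathscr{S}_m'(n)=\{T\in\mathbb{Z}: T^2\le m(n-1)+1,\ T\equiv n \pmod 2\}.$$
   Context: $\mathbb{N}$ denotes the positive integers. For $m,n\in\mathbb{N}$, $\mathscr{S}_m(n)$ is the set of all $T\in\mathbb{Z}$ for which there exist $x_1,\ldots,x_m\in\mathbb{Z}$ with $x_1+\cdots+x_m=T$ and $x_1^2+\cdots+x_m^2=n$. Let $\mathscr{T}_m(n)=\{T\in\mathbb{Z}: n\equiv T \pmod 2,\ T^2<mn\}$ and $\mathscr{S}_m'(n)=\{T\in\mathscr{S}_m(n): T^2<mn\}$. $\mathscr{S}_m(n)$ is called full if $\mathscr{S}_m'(n)=\mathscr{T}_m(n)$. *)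

theory Defs imports Main
begin

(* Only the values of x on {1..m} matter, so x stands for an integer m-tuple. *)
definition S_set :: "nat \<Rightarrow> nat \<Rightarrow> int set" where
  "S_set m n = {T. \<exists>x :: nat \<Rightarrow> int.
     (\<Sum>i=1..m. x i) = T \<and> (\<Sum>i=1..m. (x i)\<^sup>2) = int n}"

definition T_set :: "nat \<Rightarrow> nat \<Rightarrow> int set" where
  "T_set m n = {T. int n mod 2 = T mod 2 \<and> T\<^sup>2 < int m * int n}"

definition S_set' :: "nat \<Rightarrow> nat \<Rightarrow> int set" where
  "S_set' m n = {T \<in> S_set m n. T\<^sup>2 < int m * int n}"

definition S_full :: "nat \<Rightarrow> nat \<Rightarrow> bool" where
  "S_full m n \<longleftrightarrow> S_set' m n = T_set m n"

end

theory Submission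
  imports Defs "HOL-Computational_Algebra.Primes"
begin

text \<open>Write eight integers as four pairs with sums \<open>s\<^sub>i\<close> and differences \<open>d\<^sub>i \<equiv> s\<^sub>i (mod 2)\<close>.
  Their sum is \<open>\<Sum>s\<^sub>i\<close> and twice their sum of squares is \<open>\<Sum>s\<^sub>i\<^sup>2 + \<Sum>d\<^sub>i\<^sup>2\<close>. Taking all \<open>s\<^sub>i\<close>
  close to \<open>T/4\<close>, but not all odd, Lagrange's four-square theorem represents \<open>2n - \<Sum>s\<^sub>i\<^sup>2\<close> by
  \<open>d\<^sub>i\<close> of the right parities, because the residue modulo 4 determines how many of the \<open>d\<^sub>i\<close> are
  odd. For more than eight variables, a last coordinate close to \<open>T/(m+1)\<close> reduces \<open>m + 1\<close>
  variables to \<open>m\<close>; the small possible values of \<open>mn - T\<^sup>2\<close> that the size estimate leaves are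
  excluded because \<open>-T\<^sup>2\<close> takes few residues modulo \<open>m\<close>.\<close>

section \<open>Lagrange's four-square theorem\<close>

definition sum4 :: "int \<Rightarrow> bool" where
  "sum4 N \<longleftrightarrow> (\<exists>a b c d. N = a\<^sup>2 + b\<^sup>2 + c\<^sup>2 + d\<^sup>2)"

lemma sum4I: "N = a\<^sup>2 + b\<^sup>2 + c\<^sup>2 + d\<^sup>2 \<Longrightarrow> sum4 N"
  unfolding sum4_def by blast

text \<open>Multiplicativity of the quaternion norm, with signs such that the last three terms
  vanish modulo \<open>m\<close> when \<open>(w, x, y, z)\<close> and \<open>(a, b, c, d)\<close>
  agree modulo \<open>m\<close>; this lets the descent divide by \<open>m\<close>.\<close>

lemma euler_four_square:
  fixes a b c d w x y z :: int
  shows "(a\<^sup>2 + b\<^sup>2 + c\<^sup>2 + d\<^sup>2) * (w\<^sup>2 + x\<^sup>2 + y\<^sup>2 + z\<^sup>2) =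
    (a*w + b*x + c*y + d*z)\<^sup>2 + (a*x - b*w + c*z - d*y)\<^sup>2 +
    (a*y - c*w + d*x - b*z)\<^sup>2 + (a*z - d*w + b*y - c*x)\<^sup>2"
  by (simp add: power2_eq_square algebra_simps)

lemma sum4_mult: "sum4 M \<Longrightarrow> sum4 N \<Longrightarrow> sum4 (M * N)"
  unfolding sum4_def using euler_four_square by metis

lemma balanced_residue:
  fixes x m :: int
  assumes "m > 0"
  obtains y k where "x = y + m * k" "2 * \<bar>y\<bar> \<le> m"
proof (cases "2 * (x mod m) \<le> m")
  case True
  show ?thesis
    by (rule that[of "x mod m" "x div m"]) (use True assms in auto)
next
  case False
  have "x mod m < m" using assms by simp
  then show ?thesis
    using False by (intro that[of "x mod m - m" "x div m + 1"]) (auto simp: algebra_simps)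
qed

lemma four_times_square_le:
  fixes y m :: int
  assumes "2 * \<bar>y\<bar> \<le> m"
  shows "4 * y\<^sup>2 \<le> m\<^sup>2" and "4 * y\<^sup>2 = m\<^sup>2 \<longleftrightarrow> 2 * \<bar>y\<bar> = m"
proof -
  have m: "m \<ge> 0" using assms by linarith
  have e: "4 * y\<^sup>2 = (2 * \<bar>y\<bar>)\<^sup>2" by (simp add: power_mult_distrib)
  show "4 * y\<^sup>2 \<le> m\<^sup>2" unfolding e using assms by (intro power_mono) auto
  show "4 * y\<^sup>2 = m\<^sup>2 \<longleftrightarrow> 2 * \<bar>y\<bar> = m"
    unfolding e using m by (intro power2_eq_iff_nonneg) auto
qed

text \<open>\<open>p\<close> divides \<open>(x - y) * (x + y)\<close>, and both factors are below
  \<open>p\<close> in absolute value.\<close>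

lemma square_inj_mod_prime:
  fixes p x y :: int
  assumes "prime p" "0 \<le> x" "0 \<le> y" "2 * x < p" "2 * y < p" "p dvd x\<^sup>2 - y\<^sup>2"
  shows "x = y"
proof -
  have "p dvd (x - y) * (x + y)"
    using assms(6) by (simp add: power2_eq_square algebra_simps)
  then have "p dvd x - y \<or> p dvd x + y"
    using assms(1) by (simp add: prime_dvd_mult_iff)
  moreover have "x = y" if "p dvd x + y"
    using zdvd_imp_le[OF that] assms by linarith
  moreover have "x = y" if "p dvd x - y"
    using dvd_imp_le_int[OF _ that] assms by linarith
  ultimately show ?thesis by blast
qed

text \<open>Pigeonhole: the values \<open>x\<^sup>2\<close> and \<open>- 1 - y\<^sup>2\<close> over
  \<open>{0..h}\<close> each fill \<open>h + 1\<close> residues, and \<open>2 * h + 2\<close>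
  exceeds \<open>p\<close>.\<close>

lemma prime_dvd_two_squares_plus_one:
  fixes p :: int
  assumes p: "prime p" "odd p"
  obtains x y where "p dvd x\<^sup>2 + y\<^sup>2 + 1" "0 \<le> x" "2 * x < p" "0 \<le> y" "2 * y < p"
proof -
  obtain h where h: "p = 2 * h + 1" using p(2) by (elim oddE)
  have "p \<ge> 2" using p(1) by (simp add: prime_ge_2_int)
  then have h1: "h \<ge> 0" using h by linarith
  define f g where "f = (\<lambda>x::int. x\<^sup>2 mod p)" and "g = (\<lambda>y::int. (- 1 - y\<^sup>2) mod p)"
  have "inj_on f {0..h}"
  proof (rule inj_onI)
    fix x y assume *: "x \<in> {0..h}" "y \<in> {0..h}" "f x = f y"
    then have "p dvd x\<^sup>2 - y\<^sup>2" by (simp add: f_def mod_eq_dvd_iff)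
    then show "x = y"
      using * h by (intro square_inj_mod_prime[OF p(1)]) auto
  qed
  then have cf: "card (f ` {0..h}) = nat (h + 1)" by (simp add: card_image)
  have "inj_on g {0..h}"
  proof (rule inj_onI)
    fix x y assume *: "x \<in> {0..h}" "y \<in> {0..h}" "g x = g y"
    then have "p dvd y\<^sup>2 - x\<^sup>2" by (simp add: g_def mod_eq_dvd_iff)
    then have "p dvd x\<^sup>2 - y\<^sup>2" by (subst dvd_diff_commute)
    then show "x = y"
      using * h by (intro square_inj_mod_prime[OF p(1)]) auto
  qed
  then have cg: "card (g ` {0..h}) = nat (h + 1)" by (simp add: card_image)
  have "f ` {0..h} \<inter> g ` {0..h} \<noteq> {}"
  proof
    assume "f ` {0..h} \<inter> g ` {0..h} = {}"
    then have "card (f ` {0..h} \<union> g ` {0..h}) = nat (h + 1) + nat (h + 1)"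
      by (subst card_Un_disjoint) (auto simp: cf cg)
    moreover have "f ` {0..h} \<union> g ` {0..h} \<subseteq> {0..<p}"
      using \<open>p \<ge> 2\<close> by (auto simp: f_def g_def)
    then have "card (f ` {0..h} \<union> g ` {0..h}) \<le> card {0..<p}" by (intro card_mono) auto
    ultimately show False using h h1 by simp
  qed
  then obtain x y where xy: "x \<in> {0..h}" "y \<in> {0..h}" "f x = g y"
    unfolding image_def by blast
  then have "p dvd x\<^sup>2 - (- 1 - y\<^sup>2)" by (simp add: f_def g_def mod_eq_dvd_iff)
  then show ?thesis using xy h by (intro that[of x y]) (auto simp: algebra_simps)
qed

text \<open>Reduce the four roots to balanced residues modulo \<open>m\<close>; their squares sum to
  \<open>m * m'\<close> with \<open>m' \<le> m\<close>. Euler's identity then represents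
  \<open>m * m * (m' * p)\<close> by roots that are all divisible by \<open>m\<close>.\<close>

lemma sum4_descent:
  fixes p m :: int
  assumes p: "prime p" and m: "1 < m" "m < p" and s: "sum4 (m * p)"
  obtains m' where "0 < m'" "m' < m" "sum4 (m' * p)"
proof -
  obtain a b c d where s: "m * p = a\<^sup>2 + b\<^sup>2 + c\<^sup>2 + d\<^sup>2"
    using s unfolding sum4_def by blast
  have m0: "m > 0" using m by simp
  obtain w k1 where w: "a = w + m * k1" "2 * \<bar>w\<bar> \<le> m" using balanced_residue[OF m0] by metis
  obtain x k2 where x: "b = x + m * k2" "2 * \<bar>x\<bar> \<le> m" using balanced_residue[OF m0] by metis
  obtain y k3 where y: "c = y + m * k3" "2 * \<bar>y\<bar> \<le> m" using balanced_residue[OF m0] by metis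
  obtain z k4 where z: "d = z + m * k4" "2 * \<bar>z\<bar> \<le> m" using balanced_residue[OF m0] by metis
  define Q where "Q = w\<^sup>2 + x\<^sup>2 + y\<^sup>2 + z\<^sup>2"
  define C where "C = k1\<^sup>2 + k2\<^sup>2 + k3\<^sup>2 + k4\<^sup>2"
  define L where "L = k1 * w + k2 * x + k3 * y + k4 * z"
  have expand: "m * p = Q + 2 * m * L + m\<^sup>2 * C"
    unfolding s Q_def C_def L_def w(1) x(1) y(1) z(1)
    by (simp add: power2_eq_square algebra_simps)
  define m' where "m' = p - 2 * L - m * C"
  have Q: "Q = m * m'"
    using expand unfolding m'_def by (simp add: power2_eq_square algebra_simps)
  have not_dvd: "\<not> m dvd p"
  proof
    assume "m dvd p"
    then have "m = 1 \<or> m = p" using p m0 unfolding prime_int_iff by (meson less_imp_le)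
    then show False using m by simp
  qed
  have "Q \<ge> 0" unfolding Q_def by simp
  then have "m' \<ge> 0" using Q m0 by (simp add: zero_le_mult_iff)
  have bounds: "4 * w\<^sup>2 \<le> m\<^sup>2" "4 * x\<^sup>2 \<le> m\<^sup>2" "4 * y\<^sup>2 \<le> m\<^sup>2" "4 * z\<^sup>2 \<le> m\<^sup>2"
    by (intro four_times_square_le(1) w x y z)+
  then have "Q \<le> m * m" unfolding Q_def power2_eq_square by linarith
  then have "m' \<le> m" using Q m0 by simp
  \<comment> \<open>If all residues vanish, \<open>m\<^sup>2\<close> divides \<open>m * p\<close>,
    so \<open>m\<close> divides \<open>p\<close>.\<close>
  have "m' \<noteq> 0"
  proof
    assume "m' = 0"
    then have "Q = 0" using Q by simp
    then have "w = 0" "x = 0" "y = 0" "z = 0"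
      unfolding Q_def by (simp_all add: add_nonneg_eq_0_iff)
    then have "L = 0" unfolding L_def by simp
    with \<open>m' = 0\<close> have "p = m * C" unfolding m'_def by simp
    then show False using not_dvd by simp
  qed
  \<comment> \<open>Equality forces every residue to be half of \<open>m\<close> in absolute value;
    then \<open>m\<close> divides \<open>2 * L\<close>, hence again \<open>p\<close>.\<close>
  moreover have "m' \<noteq> m"
  proof
    assume "m' = m"
    then have "Q = m\<^sup>2" using Q by (simp add: power2_eq_square)
    then have "4 * w\<^sup>2 = m\<^sup>2" "4 * x\<^sup>2 = m\<^sup>2" "4 * y\<^sup>2 = m\<^sup>2" "4 * z\<^sup>2 = m\<^sup>2"
      using bounds unfolding Q_def by linarith+
    then have "2 * \<bar>w\<bar> = m" "2 * \<bar>x\<bar> = m" "2 * \<bar>y\<bar> = m" "2 * \<bar>z\<bar> = m"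
      using four_times_square_le(2)[OF w(2)] four_times_square_le(2)[OF x(2)]
        four_times_square_le(2)[OF y(2)] four_times_square_le(2)[OF z(2)] by blast+
    then have "m dvd 2 * w" "m dvd 2 * x" "m dvd 2 * y" "m dvd 2 * z"
      by (auto simp: abs_if split: if_splits)
    then have "m dvd k1 * (2 * w) + k2 * (2 * x) + k3 * (2 * y) + k4 * (2 * z)"
      by (simp only: dvd_add dvd_mult)
    also have "\<dots> = 2 * L" unfolding L_def by (simp add: algebra_simps)
    finally have "m dvd m' + 2 * L + m * C" using \<open>m' = m\<close> by simp
    then show False using not_dvd unfolding m'_def by simp
  qed
  moreover have "sum4 (m' * p)"
  proof -
    \<comment> \<open>The quotients by \<open>m\<close> of the four terms in Euler's identity; the
      first is \<open>m' + L\<close> written out.\<close>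
    define z1 where "z1 = p - L - m * C"
    define z2 where "z2 = k1*x - k2*w + k3*z - k4*y"
    define z3 where "z3 = k1*y - k3*w + k4*x - k2*z"
    define z4 where "z4 = k1*z - k4*w + k2*y - k3*x"
    have "m * m * (m' * p) = (m * p) * Q" unfolding Q by simp
    also have "\<dots> = (a*w + b*x + c*y + d*z)\<^sup>2 + (a*x - b*w + c*z - d*y)\<^sup>2 +
        (a*y - c*w + d*x - b*z)\<^sup>2 + (a*z - d*w + b*y - c*x)\<^sup>2"
      unfolding s Q_def by (rule euler_four_square)
    also have "a*w + b*x + c*y + d*z = Q + m * L"
      unfolding w(1) x(1) y(1) z(1) Q_def L_def by (simp add: power2_eq_square algebra_simps)
    also have "\<dots> = m * z1"
      unfolding z1_def Q m'_def by (simp add: algebra_simps)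
    also have "a*x - b*w + c*z - d*y = m * z2"
      unfolding w(1) x(1) y(1) z(1) z2_def by (simp add: algebra_simps)
    also have "a*y - c*w + d*x - b*z = m * z3"
      unfolding w(1) x(1) y(1) z(1) z3_def by (simp add: algebra_simps)
    also have "a*z - d*w + b*y - c*x = m * z4"
      unfolding w(1) x(1) y(1) z(1) z4_def by (simp add: algebra_simps)
    also have "(m * z1)\<^sup>2 + (m * z2)\<^sup>2 + (m * z3)\<^sup>2 + (m * z4)\<^sup>2 =
        m * m * (z1\<^sup>2 + z2\<^sup>2 + z3\<^sup>2 + z4\<^sup>2)"
      by (simp add: power2_eq_square algebra_simps)
    finally have "m' * p = z1\<^sup>2 + z2\<^sup>2 + z3\<^sup>2 + z4\<^sup>2" using m0 by simp
    then show ?thesis by (rule sum4I)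
  qed
  ultimately show ?thesis using \<open>m' \<ge> 0\<close> \<open>m' \<le> m\<close> by (intro that[of m']) auto
qed

lemma sum4_prime:
  fixes p :: int
  assumes p: "prime p"
  shows "sum4 p"
proof (cases "odd p")
  case False
  then have "p = 2" using p primes_dvd_imp_eq[of 2 p] by simp
  then show ?thesis by (intro sum4I[of _ 1 1 0 0]) simp
next
  case True
  then obtain x y where xy: "p dvd x\<^sup>2 + y\<^sup>2 + 1" "0 \<le> x" "2 * x < p" "0 \<le> y" "2 * y < p"
    using prime_dvd_two_squares_plus_one[OF p] by metis
  have p0: "p > 0" using p by (simp add: prime_gt_0_int)
  obtain m where m: "x\<^sup>2 + y\<^sup>2 + 1 = p * m" using xy(1) by (elim dvdE)
  have "p * m > 0" unfolding m[symmetric] by (simp add: add_nonneg_pos)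
  then have "m > 0" using p0 by (simp add: zero_less_mult_iff)
  \<comment> \<open>Roots below \<open>p / 2\<close> keep \<open>x\<^sup>2 + y\<^sup>2 + 1\<close>
    under \<open>p * p\<close>, so the descent can start with \<open>m < p\<close>.\<close>
  have "4 * x\<^sup>2 \<le> p\<^sup>2" "4 * y\<^sup>2 \<le> p\<^sup>2" 
    using xy by (simp_all add: four_times_square_le(1))
  moreover have "p \<ge> 2" using p by (simp add: prime_ge_2_int)
  then have "p * p \<ge> 2 * 2" by (intro mult_mono) auto
  ultimately have "p * m < p * p" unfolding m[symmetric] power2_eq_square by linarith
  then have "m < p" using p0 by simp
  have "sum4 (m * p)" using m by (intro sum4I[of _ x y 1 0]) (simp add: algebra_simps)
  with \<open>m > 0\<close> \<open>m < p\<close> show ?thesis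
  proof (induction "nat m" arbitrary: m rule: less_induct)
    case less
    show ?case
    proof (cases "m = 1")
      case True
      then show ?thesis using less.prems by simp
    next
      case False
      then have "1 < m" using less.prems by simp
      then obtain m' where "0 < m'" "m' < m" "sum4 (m' * p)"
        using sum4_descent[OF p] less.prems by metis
      then show ?thesis using less.hyps[of m'] less.prems by auto
    qed
  qed
qed

theorem lagrange_four_square: "N \<ge> 0 \<Longrightarrow> sum4 N"
proof (induction "nat N" arbitrary: N rule: less_induct)
  case less
  consider "N = 0" | "N = 1" | "N \<ge> 2" using less.prems by linarith
  then show ?case
  proof cases
    case 3
    then have "\<not> is_unit N" "N \<noteq> 0" by auto
    then obtain p where p: "prime p" "p dvd N" using prime_divisor_exists[of N] by blast
    then obtain k where k: "N = p * k" by (elim dvdE)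
    have p2: "p \<ge> 2" using p by (simp add: prime_ge_2_int)
    have k0: "k > 0" using 3 p2 unfolding k by (intro zero_less_mult_pos[of p k]) auto
    then have "2 * k \<le> p * k" using p2 by (intro mult_right_mono) auto
    then have "k < N" using k k0 by linarith
    then have "sum4 k" using less.hyps[of k] k0 by simp
    then show ?thesis unfolding k by (rule sum4_mult[OF sum4_prime[OF p(1)]])
  next
    case 1
    then show ?thesis by (intro sum4I[of _ 0 0 0 0]) simp
  next
    case 2
    then show ?thesis by (intro sum4I[of _ 1 0 0 0]) simp
  qed
qed

section \<open>Four squares with prescribed parities\<close>

lemma square_mod_4: "(x::int)\<^sup>2 mod 4 = of_bool (odd x)"
proof -
  have "x mod 4 \<in> {0, 1, 2, 3}" by simp presburger
  moreover have "x\<^sup>2 mod 4 = (x mod 4)\<^sup>2 mod 4" by (rule power_mod[symmetric])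
  ultimately have "x\<^sup>2 mod 4 = of_bool (x mod 4 \<in> {1, 3})" by (elim insertE) simp_all
  also have "x mod 4 \<in> {1, 3} \<longleftrightarrow> odd x" by simp presburger
  finally show ?thesis .
qed

lemma sum4_mod_4:
  "(a + b + c + d) mod 4 = (a mod 4 + b mod 4 + c mod 4 + d mod 4) mod (4::int)"
  by (intro mod_add_cong) simp_all

text \<open>Modulo 4 a sum of four squares counts its odd roots, so the residue fixes their number,
  except that 0 allows none or four.\<close>

lemma four_squares_parity:
  fixes N :: int
  assumes N: "N \<ge> 0" and k: "N mod 4 = k"
  obtains a b c d where "N = a\<^sup>2 + b\<^sup>2 + c\<^sup>2 + d\<^sup>2"
    "odd a \<longleftrightarrow> 1 \<le> k" "odd b \<longleftrightarrow> 2 \<le> k" "odd c \<longleftrightarrow> 3 \<le> k" "even d"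
proof (cases "k = 0")
  \<comment> \<open>Four odd roots are avoided by doubling a representation of
    \<open>N / 4\<close>.\<close>
  case True
  then obtain M where M: "N = 4 * M" using k by auto
  then obtain a b c d where "M = a\<^sup>2 + b\<^sup>2 + c\<^sup>2 + d\<^sup>2"
    using lagrange_four_square[of M] N unfolding sum4_def by auto
  then show ?thesis
    using M True by (intro that[of "2*a" "2*b" "2*c" "2*d"]) (auto simp: power_mult_distrib)
next
  case False
  obtain a b c d where abcd: "N = a\<^sup>2 + b\<^sup>2 + c\<^sup>2 + d\<^sup>2"
    using lagrange_four_square[OF N] unfolding sum4_def by auto
  \<comment> \<open>\<open>False < True\<close>, so sorting by \<open>even\<close> puts the odd
    roots first.\<close>
  define xs where "xs = sort_key even [a, b, c, d]"
  have "length xs = 4" unfolding xs_def by (simp only: length_sort) simp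
  then obtain a' b' c' d' where xs: "xs = [a', b', c', d']"
    by (auto simp: numeral_eq_Suc length_Suc_conv)
  have ms: "mset xs = mset [a, b, c, d]" unfolding xs_def by (rule mset_sort)
  have "sum_list (map (\<lambda>x. x\<^sup>2) xs) = sum_mset (image_mset (\<lambda>x. x\<^sup>2) (mset xs))"
    by (simp add: sum_mset_sum_list flip: mset_map)
  also have "\<dots> = N" unfolding ms abcd by simp
  finally have N': "N = a'\<^sup>2 + b'\<^sup>2 + c'\<^sup>2 + d'\<^sup>2" unfolding xs by simp
  have "sorted (map even xs)" unfolding xs_def by (rule sorted_sort_key)
  then have srt: "even a' \<longrightarrow> even b'" "even b' \<longrightarrow> even c'" "even c' \<longrightarrow> even d'"
    unfolding xs by auto
  have "N mod 4 = (a'\<^sup>2 mod 4 + b'\<^sup>2 mod 4 + c'\<^sup>2 mod 4 + d'\<^sup>2 mod 4) mod 4"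
    unfolding N' by (rule sum4_mod_4)
  then have "k = (of_bool (odd a') + of_bool (odd b') + of_bool (odd c') + of_bool (odd d')) mod 4"
    unfolding square_mod_4 k .
  then show ?thesis
    using N' srt False
    by (intro that[of a' b' c' d']) (auto simp: of_bool_def split: if_splits)
qed

section \<open>Eight variables\<close>

lemma S_set_list:
  assumes "sum_list xs = T" "sum_list (map (\<lambda>x. x\<^sup>2) xs) = int n"
  shows "T \<in> S_set (length xs) n"
  unfolding S_set_def
\<comment> \<open>List positions start at 0, tuple indices at 1.\<close>
proof (intro CollectI exI[of _ "\<lambda>i. xs ! (i - 1)"] conjI)
  show "(\<Sum>i = 1..length xs. xs ! (i - 1)) = T"
    using assms(1)
    by (simp add: sum.atLeast1_atMost_eq sum_list_sum_nth atLeast0LessThan)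
  show "(\<Sum>i = 1..length xs. (xs ! (i - 1))\<^sup>2) = int n"
    using assms(2)
    by (simp add: sum.atLeast1_atMost_eq sum_list_sum_nth atLeast0LessThan)
qed

lemma S_set_Suc:
  assumes "T \<in> S_set m n" "int n' = int n + y\<^sup>2"
  shows "T + y \<in> S_set (Suc m) n'"
proof -
  obtain x where "(\<Sum>i=1..m. x i) = T" "(\<Sum>i=1..m. (x i)\<^sup>2) = int n"
    using assms(1) unfolding S_set_def by auto
  then show ?thesis
    unfolding S_set_def using assms(2)
    by (intro CollectI exI[of _ "x(Suc m := y)"]) simp
qed

text \<open>The order of the \<open>s\<close> entries, odd before even, is the one delivered by
  \<open>four_squares_parity\<close>, so \<open>s\<close> and \<open>d\<close> agree in parity entry
  by entry. \<open>even s4\<close> excludes four odd sums, for which residue 0 would yield even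
  \<open>d\<close>.\<close>

lemma S_set_8I:
  fixes s1 s2 s3 s4 :: int
  assumes srt: "even s1 \<longrightarrow> even s2" "even s2 \<longrightarrow> even s3" "even s4"
    and T: "s1 + s2 + s3 + s4 = T" and par: "T mod 2 = int n mod 2"
    and le: "s1\<^sup>2 + s2\<^sup>2 + s3\<^sup>2 + s4\<^sup>2 \<le> 2 * int n"
  shows "T \<in> S_set 8 n"
proof -
  define R where "R = 2 * int n - (s1\<^sup>2 + s2\<^sup>2 + s3\<^sup>2 + s4\<^sup>2)"
  define k :: int where "k = of_bool (odd s1) + of_bool (odd s2) + of_bool (odd s3)"
  have "R mod 4 = (2 * int n - (s1\<^sup>2 mod 4 + s2\<^sup>2 mod 4 + s3\<^sup>2 mod 4 + s4\<^sup>2 mod 4)) mod 4"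
    unfolding R_def by (subst mod_diff_right_eq[symmetric], subst sum4_mod_4) (rule mod_diff_right_eq)
  also have "\<dots> = (2 * int n - k) mod 4"
    unfolding square_mod_4 k_def using srt(3) by simp
  \<comment> \<open>\<open>k\<close> counts the odd \<open>s\<close> entries, so \<open>k\<close>,
    \<open>T\<close> and \<open>n\<close> share their parity and \<open>2 * n - k\<close> is
    congruent to \<open>2 * k - k\<close> modulo 4.\<close>
  also have "\<dots> = k"
  proof -
    have "even k \<longleftrightarrow> even T"
      unfolding k_def T[symmetric] using srt(3)
      by (cases "odd s1"; cases "odd s2"; cases "odd s3") simp_all
    then have "even (int n - k)" using par by presburger
    then obtain j where "int n - k = 2 * j" by (rule evenE)
    then have "2 * int n - k = k + 4 * j" by simp
    moreover have "0 \<le> k" "k < 4" unfolding k_def by auto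
    ultimately show ?thesis by simp
  qed
  finally have Rk: "R mod 4 = k" .
  have "R \<ge> 0" using le unfolding R_def by simp
  then obtain d1 d2 d3 d4 where d: "R = d1\<^sup>2 + d2\<^sup>2 + d3\<^sup>2 + d4\<^sup>2"
    "odd d1 \<longleftrightarrow> 1 \<le> k" "odd d2 \<longleftrightarrow> 2 \<le> k" "odd d3 \<longleftrightarrow> 3 \<le> k" "even d4"
    using Rk by (rule four_squares_parity)
  have "1 \<le> k \<longleftrightarrow> odd s1" "2 \<le> k \<longleftrightarrow> odd s2" "3 \<le> k \<longleftrightarrow> odd s3"
    using srt(1,2) unfolding k_def
    by (cases "odd s1"; cases "odd s2"; cases "odd s3"; simp)+
  then have "even (d1 - s1)" "even (d2 - s2)" "even (d3 - s3)" "even (d4 - s4)"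
    using d(2-5) srt(3) by simp_all
  then obtain e1 e2 e3 e4 where "d1 - s1 = 2 * e1" "d2 - s2 = 2 * e2"
    "d3 - s3 = 2 * e3" "d4 - s4 = 2 * e4"
    by (metis dvdE)
  then have e: "d1 = s1 + 2 * e1" "d2 = s2 + 2 * e2" "d3 = s3 + 2 * e3" "d4 = s4 + 2 * e4"
    by simp_all
  \<comment> \<open>Each pair has sum \<open>s\<close> and difference
    \<open>d = s + 2 * e\<close>.\<close>
  let ?xs = "[s1 + e1, - e1, s2 + e2, - e2, s3 + e3, - e3, s4 + e4, - e4]"
  have "sum_list ?xs = T" using T by simp
  moreover have "2 * sum_list (map (\<lambda>x. x\<^sup>2) ?xs) = 2 * int n"
    using d(1) unfolding R_def e by (simp add: power2_eq_square algebra_simps)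
  ultimately have *: "T \<in> S_set (length ?xs) n" by (intro S_set_list) auto
  have "length ?xs = 8" by simp
  with * show ?thesis by (simp only:)
qed

text \<open>For \<open>T = 4 * a\<close> with \<open>a\<close> odd the balanced choice \<open>(a, a, a, a)\<close> is all odd and is replaced
  by \<open>(a, a, a - 1, a + 1)\<close>.\<close>

lemma S_set_8:
  assumes par: "T mod 2 = int n mod 2" and lt: "T\<^sup>2 < 8 * int n"
  shows "T \<in> S_set 8 n"
proof -
  define a where "a = T div 4"
  note intro = S_set_8I[OF _ _ _ _ par] and sq = power2_eq_square algebra_simps
  have "T = 4 * a \<or> T = 4 * a + 1 \<or> T = 4 * a + 2 \<or> T = 4 * a + 3"
    unfolding a_def by presburger
  then consider "T = 4 * a" | "T = 4 * a + 1" | "T = 4 * a + 2" | "T = 4 * a + 3" by blast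
  then show ?thesis
  proof cases
    case 1
    \<comment> \<open>Integrality turns \<open>2 * (a * a) < n\<close> into a slack of 2 in
      \<open>2 * n\<close>, which pays for \<open>a - 1\<close> and \<open>a + 1\<close>.\<close>
    have "2 * (a * a) + 1 \<le> int n" using lt unfolding 1 by (simp add: sq)
    then show ?thesis
      using 1 intro[of a a a a] intro[of a a "a - 1" "a + 1"]
      by (cases "even a") (simp_all add: sq)
  next
    case 2
    have "2 * (a * a) + a + 1 \<le> int n" using lt unfolding 2 by (simp add: sq)
    \<comment> \<open>The two orderings serve the two parities of \<open>a\<close>: odd entries
      first, an even one last.\<close>
    then show ?thesis
      using 2 intro[of "a + 1" a a a] intro[of a a a "a + 1"]
      by (cases "even a") (simp_all add: sq)
  next
    case 3
    have "2 * (a * a) + 2 * a + 1 \<le> int n" using lt unfolding 3 by (simp add: sq)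
    then show ?thesis
      using 3 intro[of "a + 1" "a + 1" a a] intro[of a a "a + 1" "a + 1"]
      by (cases "even a") (simp_all add: sq)
  next
    case 4
    have "2 * (a * a) + 3 * a + 2 \<le> int n" using lt unfolding 4 by (simp add: sq)
    then show ?thesis
      using 4 intro[of "a + 1" "a + 1" "a + 1" a] intro[of a "a + 1" "a + 1" "a + 1"]
      by (cases "even a") (simp_all add: sq)
  qed
qed

section \<open>Passing from eight to eleven variables\<close>

text \<open>The skipped values would need \<open>t\<^sup>2\<close> congruent to 2 modulo 8, or to 2
  or 3 modulo 9 or 10, which are not squares there.\<close>

lemma square_residues_8_9_10:
  fixes n t :: int
  shows "6 \<le> 8 * n - t\<^sup>2 \<Longrightarrow> 7 \<le> 8 * n - t\<^sup>2"
    and "6 \<le> 9 * n - t\<^sup>2 \<Longrightarrow> 8 \<le> 9 * n - t\<^sup>2"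
    and "7 \<le> 10 * n - t\<^sup>2 \<Longrightarrow> 9 \<le> 10 * n - t\<^sup>2"
proof -
  have "t mod 8 \<in> {0,1,2,3,4,5,6,7}" by simp presburger
  moreover have "t\<^sup>2 mod 8 = (t mod 8)\<^sup>2 mod 8" by (simp add: power_mod)
  ultimately have "t\<^sup>2 mod 8 \<noteq> 2" by auto
  then show "6 \<le> 8 * n - t\<^sup>2 \<Longrightarrow> 7 \<le> 8 * n - t\<^sup>2" by presburger
  have "t mod 9 \<in> {0,1,2,3,4,5,6,7,8}" by simp presburger
  moreover have "t\<^sup>2 mod 9 = (t mod 9)\<^sup>2 mod 9" by (simp add: power_mod)
  ultimately have "t\<^sup>2 mod 9 \<notin> {2, 3}" by auto
  then show "6 \<le> 9 * n - t\<^sup>2 \<Longrightarrow> 8 \<le> 9 * n - t\<^sup>2" by simp presburger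
  have "t mod 10 \<in> {0,1,2,3,4,5,6,7,8,9}" by simp presburger
  moreover have "t\<^sup>2 mod 10 = (t mod 10)\<^sup>2 mod 10" by (simp add: power_mod)
  ultimately have "t\<^sup>2 mod 10 \<notin> {2, 3}" by auto
  then show "7 \<le> 10 * n - t\<^sup>2 \<Longrightarrow> 9 \<le> 10 * n - t\<^sup>2" by simp presburger
qed

text \<open>The inequality is \<open>T\<^sup>2 \<le> m * (n - 1) + 1\<close>, rearranged as a bound
  on the deficit \<open>m * n - T\<^sup>2\<close> that the induction on \<open>m\<close>
  controls.\<close>

definition fills :: "nat \<Rightarrow> bool" where
  "fills m \<longleftrightarrow> (\<forall>n T. T mod 2 = int n mod 2 \<longrightarrow> int m - 1 \<le> int m * int n - T\<^sup>2 \<longrightarrow> T \<in> S_set m n)"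

text \<open>Split off a coordinate \<open>y\<close> nearest to \<open>T / (m + 1)\<close>: by
  \<open>key\<close> the deficit is scaled by \<open>m / (m + 1)\<close> and loses only
  \<open>r\<^sup>2 / (m + 1)\<close>, kept small by the choice of \<open>y\<close>.\<close>

lemma fills_Suc:
  assumes fills: "fills m" and m: "m \<in> {8, 9, 10}"
  shows "fills (Suc m)"
  unfolding fills_def
proof (intro allI impI)
  fix n T
  assume par: "T mod 2 = int n mod 2" and D: "int (Suc m) - 1 \<le> int (Suc m) * int n - T\<^sup>2"
  define M where "M = int m"
  obtain r y where y: "T = r + (M + 1) * y" "2 * \<bar>r\<bar> \<le> M + 1"
    using balanced_residue[of "M + 1" T] unfolding M_def by auto
  define n' t where "n' = int n - y\<^sup>2" and "t = T - y"
  have key: "(M + 1) * (M * n' - t\<^sup>2) = M * ((M + 1) * int n - T\<^sup>2) - r\<^sup>2"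
    unfolding n'_def t_def y(1) by (simp add: power2_eq_square algebra_simps)
  have D: "M \<le> (M + 1) * int n - T\<^sup>2" using D unfolding M_def by (simp add: algebra_simps)
  consider "M = 8" | "M = 9" | "M = 10" using m unfolding M_def by auto
  then have D': "M - 1 \<le> M * n' - t\<^sup>2"
  proof cases
    case 1
    \<comment> \<open>For the new deficit \<open>X\<close>, \<open>9 * X \<ge> 64 - 16\<close> gives
      \<open>X \<ge> 6\<close> by integrality, and the residues lift this to 7. The other cases rest
      on \<open>10 * X \<ge> 81 - 25\<close> and \<open>11 * X \<ge> 100 - 25\<close>.\<close>
    have "r\<^sup>2 \<le> 4\<^sup>2" using y(2) 1 by (subst abs_le_square_iff[symmetric]) linarith
    then have "6 \<le> 8 * n' - t\<^sup>2" using 1 key D by simp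
    then show ?thesis using 1 square_residues_8_9_10(1)[of n' t] by simp
  next
    case 2
    have "r\<^sup>2 \<le> 5\<^sup>2" using y(2) 2 by (subst abs_le_square_iff[symmetric]) linarith
    then have "6 \<le> 9 * n' - t\<^sup>2" using 2 key D by simp
    then show ?thesis using 2 square_residues_8_9_10(2)[of n' t] by simp
  next
    case 3
    have "r\<^sup>2 \<le> 5\<^sup>2" using y(2) 3 by (subst abs_le_square_iff[symmetric]) linarith
    then have "7 \<le> 10 * n' - t\<^sup>2" using 3 key D by simp
    then show ?thesis using 3 square_residues_8_9_10(3)[of n' t] by simp
  qed
  have M: "M \<ge> 8" using m unfolding M_def by auto
  then have "M * n' \<ge> 0" using D' by (smt (verit) zero_le_power2)
  then have n': "n' \<ge> 0" using M by (simp add: zero_le_mult_iff)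
  have "t mod 2 = n' mod 2"
  proof -
    have "even (y\<^sup>2 - y)" by simp
    then show ?thesis using par unfolding t_def n'_def by presburger
  qed
  then have "t \<in> S_set m (nat n')"
    using fills D' n' unfolding fills_def M_def by auto
  then have "t + y \<in> S_set (Suc m) n" using n' by (intro S_set_Suc) (auto simp: n'_def)
  then show "T \<in> S_set (Suc m) n" by (simp add: t_def)
qed

lemma fills_8_to_11: "fills 8" "fills 9" "fills 10" "fills 11"
proof -
  show 8: "fills 8" unfolding fills_def using S_set_8 by simp
  show 9: "fills 9" using fills_Suc[OF 8] by simp
  show 10: "fills 10" using fills_Suc[OF 9] by simp
  show "fills 11" using fills_Suc[OF 10] by simp
qed

section \<open>Necessary conditions: parity and size\<close>

lemma S_set_parity:
  assumes "T \<in> S_set m n"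
  shows "T mod 2 = int n mod 2"
proof -
  obtain x where x: "(\<Sum>i=1..m. x i) = T" "(\<Sum>i=1..m. (x i)\<^sup>2) = int n"
    using assms unfolding S_set_def by auto
  have "even (\<Sum>i=1..m. (x i)\<^sup>2 - x i)" by (intro dvd_sum) simp
  then have "even (int n - T)" unfolding sum_subtractf x .
  then show ?thesis by presburger
qed

text \<open>With \<open>q = T div m\<close> every term of \<open>\<Sum>i. (x i - q) * (x i - q - 1)\<close> is nonnegative,
  which gives \<open>m * n - T\<^sup>2 \<ge> r * (m - r)\<close> for \<open>r = T mod m\<close>.\<close>

lemma S_set'_bound:
  assumes m: "m \<ge> 1" and T: "T \<in> S_set' m n"
  shows "T\<^sup>2 \<le> int m * (int n - 1) + 1"
proof -
  obtain x where x: "(\<Sum>i=1..m. x i) = T" "(\<Sum>i=1..m. (x i)\<^sup>2) = int n"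
    and lt: "T\<^sup>2 < int m * int n"
    using T unfolding S_set'_def S_set_def by auto
  define M q r where "M = int m" and "q = T div int m" and "r = T mod int m"
  have Tq: "T = M * q + r" unfolding M_def q_def r_def by simp
  have M: "M \<ge> 1" using m unfolding M_def by simp
  have r: "0 \<le> r" "r < M" using m unfolding r_def M_def by auto
  show ?thesis
  proof (cases "r = 0")
    \<comment> \<open>Here \<open>r * (m - r)\<close> is 0; instead the strict bound in
      \<open>S_set'\<close> gives \<open>M * q\<^sup>2 \<le> n - 1\<close> by integrality.\<close>
    case True
    then have sq: "T\<^sup>2 = M * (M * q\<^sup>2)" unfolding Tq by (simp add: power2_eq_square)
    then have "M * q\<^sup>2 < int n" using lt M unfolding M_def by simp
    then have "M * (M * q\<^sup>2) \<le> M * (int n - 1)" using M by (intro mult_left_mono) auto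
    then show ?thesis unfolding sq M_def by simp
  next
    case False
    have "0 \<le> (y - q) * (y - q - 1)" for y :: int
      by (cases "y \<le> q") (auto intro: mult_nonpos_nonpos)
    then have "0 \<le> (\<Sum>i=1..m. (x i - q) * (x i - q - 1))" by (intro sum_nonneg)
    also have "\<dots> = (\<Sum>i=1..m. (x i)\<^sup>2 - (2 * q + 1) * x i + q * (q + 1))"
      by (simp add: power2_eq_square algebra_simps)
    also have "\<dots> = int n - (2 * q + 1) * T + M * (q * (q + 1))"
      unfolding sum.distrib sum_subtractf sum_distrib_left[symmetric] x by (simp add: M_def algebra_simps)
    finally have "0 \<le> M * (int n - (2 * q + 1) * T + M * (q * (q + 1)))" using M by simp
    also have "\<dots> = M * int n - T\<^sup>2 - r * (M - r)"
      unfolding Tq by (simp add: power2_eq_square algebra_simps)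
    finally have "r * (M - r) \<le> M * int n - T\<^sup>2" by simp
    \<comment> \<open>For \<open>1 \<le> r \<le> M - 1\<close> the product
      \<open>r * (M - r)\<close> is least at the ends, where it is \<open>M - 1\<close>.\<close>
    moreover have "0 \<le> (r - 1) * (M - r - 1)" using r False by (intro mult_nonneg_nonneg) auto
    then have "M - 1 \<le> r * (M - r)" by (simp add: algebra_simps)
    ultimately show ?thesis unfolding M_def by (simp add: algebra_simps)
  qed
qed

section \<open>Both inclusions for the two claims\<close>

theorem theorem4p7:
  shows "(\<forall>n::nat. n \<ge> 1 \<longrightarrow> S_full 8 n) \<and>
    (\<forall>m n :: nat. m \<in> {9, 10, 11} \<and> n \<ge> 1 \<and> n > m \<longrightarrow>
      S_set' m n = {T :: int. T\<^sup>2 \<le> int m * (int n - 1) + 1 \<and> T mod 2 = int n mod 2})"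
proof (intro conjI allI impI)
  fix n :: nat
  show "S_full 8 n"
    unfolding S_full_def S_set'_def T_set_def
  proof (intro Collect_cong iffI conjI; elim conjE)
    fix T assume T: "T \<in> S_set 8 n" "T\<^sup>2 < int 8 * int n"
    show "int n mod 2 = T mod 2" by (rule S_set_parity[OF T(1), symmetric])
    show "T\<^sup>2 < int 8 * int n" by (rule T(2))
  next
    fix T assume T: "int n mod 2 = T mod 2" "T\<^sup>2 < int 8 * int n"
    show "T \<in> S_set 8 n" using T by (intro S_set_8) simp_all
    show "T\<^sup>2 < int 8 * int n" by (rule T(2))
  qed
next
  fix m n :: nat
  assume *: "m \<in> {9, 10, 11} \<and> n \<ge> 1 \<and> n > m"
  then have m: "fills m" "m \<ge> 9" using fills_8_to_11 by auto
  show "S_set' m n = {T. T\<^sup>2 \<le> int m * (int n - 1) + 1 \<and> T mod 2 = int n mod 2}"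
  proof (intro equalityI subsetI CollectI conjI)
    fix T assume T: "T \<in> S_set' m n"
    show "T\<^sup>2 \<le> int m * (int n - 1) + 1" using S_set'_bound[OF _ T] m by simp
    show "T mod 2 = int n mod 2" using T unfolding S_set'_def by (blast intro: S_set_parity)
  next
    fix T assume "T \<in> {T. T\<^sup>2 \<le> int m * (int n - 1) + 1 \<and> T mod 2 = int n mod 2}"
    then have T: "int m - 1 \<le> int m * int n - T\<^sup>2" "T mod 2 = int n mod 2"
      by (simp_all add: right_diff_distrib)
    then have "T \<in> S_set m n" using m(1) unfolding fills_def by blast
    \<comment> \<open>\<open>m - 1 > 0\<close> turns the deficit bound into the strict inequality of
      \<open>S_set'\<close>.\<close>
    then show "T \<in> S_set' m n" using T(1) m(2) unfolding S_set'_def by simp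
  qed
qed

end
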